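(* Let $n \geq 3$ and let $P_n$ be the path on $n$ vertices. Then $\mathcal{D}_{\mathrm{lir}}(P_n) = 0$ if $n$ is odd, and $\mathcal{D}_{\mathrm{lir}}(P_n) = 1$ if $n$ is even.
   Context: A (multi)graph is locally irregular if the two endvertices of every edge have different degrees (degrees in multigraphs count parallel edges with multiplicity). For a graph $G$ and a set $E_d \subseteq E(G)$, $G + E_d$ denotes the multigraph obtained from $G$ by replacing each edge of $E_d$ by two parallel edges. For a connected graph $G$ not isomorphic to $K_2$ or $K_3$, $\mathcal{D}_{\mathrm{lir}}(G)$ is the minimum size of a set $E_d \subseteq E(G)$ such that the edges of $G+E_d$ can be colored with at most two colors so that each color class induces a locally irregular sub(multi)graph and any two parallel edges receive the same color. *)

theory Defs
  imports Main "HOL-Library.Extended_Nat"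
begin

record 'v graph =
  gverts :: "'v set"
  gedges :: "'v set set"

text \<open>
  Edges of a multigraph are abstract, so that parallel edges are distinct edges with the same set
  of ends. All multigraphs here are loopless: \<open>ends M e\<close> has exactly two elements for every edge.
\<close>

record ('v, 'e) multigraph =
  mverts :: "'v set"
  medges :: "'e set"
  ends :: "'e \<Rightarrow> 'v set"

definition degree :: "('v, 'e) multigraph \<Rightarrow> 'v \<Rightarrow> nat" where
  "degree M v = card {e \<in> medges M. v \<in> ends M e}"

definition locally_irregular :: "('v, 'e) multigraph \<Rightarrow> bool" where
  "locally_irregular M \<longleftrightarrow>
     (\<forall>e \<in> medges M. \<forall>u v. ends M e = {u, v} \<and> u \<noteq> v \<longrightarrow> degree M u \<noteq> degree M v)"

definition induced_by_edges :: "('v, 'e) multigraph \<Rightarrow> 'e set \<Rightarrow> ('v, 'e) multigraph" where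
  "induced_by_edges M F = \<lparr>mverts = (\<Union>e \<in> F. ends M e), medges = F, ends = ends M\<rparr>"

text \<open>
  The multigraph \<open>G + E\<^sub>d\<close>, for \<open>E\<^sub>d \<subseteq> gedges G\<close>: an edge \<open>e\<close> of \<open>G\<close> becomes \<open>(e, 0)\<close>,
  and each \<open>e \<in> E\<^sub>d\<close> receives the parallel copy \<open>(e, 1)\<close>.
\<close>

definition add_parallel :: "'v graph \<Rightarrow> 'v set set \<Rightarrow> ('v, 'v set \<times> nat) multigraph" where
  "add_parallel G Ed =
     \<lparr>mverts = gverts G, medges = gedges G \<times> {0} \<union> Ed \<times> {1}, ends = fst\<rparr>"

text \<open>A colour class may be empty, which gives ``at most two colours''.\<close>

definition lir_2_colouring :: "('v, 'e) multigraph \<Rightarrow> ('e \<Rightarrow> nat) \<Rightarrow> bool" where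
  "lir_2_colouring M c \<longleftrightarrow>
     (\<forall>e \<in> medges M. c e \<in> {1, 2}) \<and>
     (\<forall>i \<in> {1, 2}. locally_irregular (induced_by_edges M {e \<in> medges M. c e = i})) \<and>
     (\<forall>e \<in> medges M. \<forall>f \<in> medges M. ends M e = ends M f \<longrightarrow> c e = c f)"

text \<open>
  The minimum is taken in \<^typ>\<open>enat\<close>, so that it is \<open>\<infinity>\<close>, rather than some
  arbitrary number, for a graph without an admissible \<open>E\<^sub>d\<close> (such as \<open>K\<^sub>2\<close> and \<open>K\<^sub>3\<close>).
  The intended arguments are finite connected graphs other than these two.
\<close>

definition D_lir :: "'v graph \<Rightarrow> enat" where
  "D_lir G =
     (INF Ed \<in> {Ed. Ed \<subseteq> gedges G \<and> finite Ed \<and> (\<exists>c. lir_2_colouring (add_parallel G Ed) c)}.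
        enat (card Ed))"

definition path_graph :: "nat \<Rightarrow> nat graph" where
  "path_graph n = \<lparr>gverts = {..<n}, gedges = {{i, Suc i} | i. Suc i < n}\<rparr>"

end

theory Submission imports Defs begin

text \<open>
  Number the edges of the path from left to right. Within a colour class, the two ends of the
  \<open>j\<close>-th edge have degrees differing by the difference of the multiplicities of the edges
  \<open>j - 1\<close> and \<open>j + 1\<close> in that class, so local irregularity says that these two multiplicities
  differ. Without parallel edges, exactly one neighbour of each edge has its colour; this
  forces the edges into consecutive monochromatic pairs, so the number of edges is even and,
  conversely, pairs of alternating colours work. For an odd number of edges, put an additional
  doubled edge in front of the first pair, in the same colour: this gives the degrees 2, 3, 2, 1.
\<close>

section \<open>Edges of the path and their incidences\<close>

lemma path_edge_eq_iff: "{i, Suc i} = {j, Suc j} \<longleftrightarrow> i = j"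
  by (auto simp: doubleton_eq_iff)

lemma path_edge_in_gedges_iff: "{j, Suc j} \<in> gedges (path_graph n) \<longleftrightarrow> Suc j < n"
  by (auto simp: path_graph_def path_edge_eq_iff)

lemma finite_gedges_path: "finite (gedges (path_graph n))"
proof -
  have "gedges (path_graph n) \<subseteq> (\<lambda>i. {i, Suc i}) ` {..<n}"
    by (auto simp: path_graph_def)
  then show ?thesis
    using finite_subset by blast
qed

lemma mem_path_edge_cases:
  assumes "fst e \<in> gedges (path_graph n)"
  shows "v \<in> fst e \<longleftrightarrow> fst e = {v, Suc v} \<or> (v > 0 \<and> fst e = {v - 1, Suc (v - 1)})"
proof -
  from assms obtain j where j: "fst e = {j, Suc j}"
    by (auto simp: path_graph_def)
  show ?thesis
    unfolding j path_edge_eq_iff by auto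
qed

section \<open>Degrees and local irregularity of a colour class\<close>

text \<open>Vertex 0 has no edge on its left. As \<open>0 - 1 = 0\<close> on naturals, without the
  case split edge 0 would count twice there.\<close>

definition left_multiplicity :: "(nat \<Rightarrow> nat) \<Rightarrow> nat \<Rightarrow> nat" where
  "left_multiplicity m v = (if v = 0 then 0 else m (v - 1))"

text \<open>Vertex \<open>v\<close> lies only on the edges numbered \<open>v - 1\<close> and
  \<open>v\<close>. The right end needs no case of its own: \<open>F\<close> has no edges beyond the
  path, so \<open>m\<close> vanishes there.\<close>

lemma degree_induced_path:
  fixes F :: "(nat set \<times> nat) set"
  assumes "finite F" and "fst ` F \<subseteq> gedges (path_graph n)"
  defines "m \<equiv> \<lambda>j. card {e \<in> F. fst e = {j, Suc j}}"
  shows "degree (induced_by_edges (add_parallel (path_graph n) Ed) F) v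
           = left_multiplicity m v + m v"
proof -
  let ?L = "if v = 0 then {} else {e \<in> F. fst e = {v - 1, Suc (v - 1)}}"
  let ?R = "{e \<in> F. fst e = {v, Suc v}}"
  have disjoint: "{v - 1, Suc (v - 1)} \<noteq> {v, Suc v}" if "v \<noteq> 0"
    using that unfolding path_edge_eq_iff by simp
  have "{e \<in> F. v \<in> fst e} = ?L \<union> ?R"
  proof (rule set_eqI)
    fix e
    show "e \<in> {e \<in> F. v \<in> fst e} \<longleftrightarrow> e \<in> ?L \<union> ?R"
    proof (cases "e \<in> F")
      case True
      with assms have "fst e \<in> gedges (path_graph n)" by blast
      with True mem_path_edge_cases[OF this, of v] show ?thesis by auto
    qed auto
  qed
  moreover have "?L \<inter> ?R = {}"
    using disjoint by (cases "v = 0") (simp, simp only: if_False, blast)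
  moreover have "finite ?L" "finite ?R"
    using assms(1) by auto
  ultimately have "card {e \<in> F. v \<in> fst e} = card ?L + card ?R"
    by (simp only: card_Un_disjoint)
  then show ?thesis
    by (simp add: degree_def induced_by_edges_def add_parallel_def m_def left_multiplicity_def)
qed

lemma locally_irregular_induced_path_iff:
  fixes F :: "(nat set \<times> nat) set"
  assumes "finite F" and "fst ` F \<subseteq> gedges (path_graph n)"
  defines "m \<equiv> \<lambda>j. card {e \<in> F. fst e = {j, Suc j}}"
  shows "locally_irregular (induced_by_edges (add_parallel (path_graph n) Ed) F) \<longleftrightarrow>
           (\<forall>j. {j, Suc j} \<in> fst ` F \<longrightarrow> left_multiplicity m j \<noteq> m (Suc j))"
    (is "locally_irregular ?M \<longleftrightarrow> ?R")
proof -
  have deg: "degree ?M v = left_multiplicity m v + m v" for v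
    unfolding m_def by (rule degree_induced_path[OF assms(1,2)])
  \<comment> \<open>The copies of edge \<open>j\<close> itself contribute \<open>m j\<close> to the
    degrees of both of its ends and cancel.\<close>
  have deg_neq: "degree ?M j \<noteq> degree ?M (Suc j) \<longleftrightarrow> left_multiplicity m j \<noteq> m (Suc j)" for j
    by (simp add: deg left_multiplicity_def)
  have M: "medges ?M = F" "ends ?M = fst"
    by (simp_all add: induced_by_edges_def add_parallel_def)
  show ?thesis
  proof
    assume "locally_irregular ?M"
    then have irregular: "degree ?M u \<noteq> degree ?M v" if "e \<in> F" "fst e = {u, v}" "u \<noteq> v" for e u v
      using that unfolding locally_irregular_def M by blast
    show ?R
    proof (intro allI impI)
      fix j
      assume "{j, Suc j} \<in> fst ` F"
      then obtain e where e: "e \<in> F" "fst e = {j, Suc j}"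
        by (elim imageE) simp
      show "left_multiplicity m j \<noteq> m (Suc j)"
        using irregular[OF e n_not_Suc_n] unfolding deg_neq .
    qed
  next
    assume R: ?R
    show "locally_irregular ?M"
      unfolding locally_irregular_def M
    proof (intro ballI allI impI)
      fix e u v
      assume e: "e \<in> F" and uv: "fst e = {u, v} \<and> u \<noteq> v"
      from e assms(2) obtain j where j: "fst e = {j, Suc j}"
        by (auto simp: path_graph_def)
      have "{j, Suc j} \<in> fst ` F"
        using imageI[OF e, of fst] unfolding j .
      with R have "degree ?M j \<noteq> degree ?M (Suc j)"
        unfolding deg_neq by simp
      moreover have "u = j \<and> v = Suc j \<or> u = Suc j \<and> v = j"
        using uv unfolding j doubleton_eq_iff by blast
      ultimately show "degree ?M u \<noteq> degree ?M v"
        by metis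
    qed
  qed
qed

section \<open>Colourings as functions of the edge number\<close>

definition path_class_multiplicity ::
    "nat \<Rightarrow> nat set set \<Rightarrow> (nat \<Rightarrow> nat) \<Rightarrow> nat \<Rightarrow> nat \<Rightarrow> nat" where
  "path_class_multiplicity n Ed k i l =
     (if Suc l < n \<and> k l = i then if {l, Suc l} \<in> Ed then 2 else 1 else 0)"

text \<open>By the assumption on \<open>k\<close>, the colour depends only on the edge number, so
  parallel edges agree automatically. Each edge lies in just one class, so the conditions for the
  two colours merge into one about the colour \<open>k j\<close> of edge \<open>j\<close>.\<close>

lemma lir_2_colouring_path_iff:
  assumes Ed: "Ed \<subseteq> gedges (path_graph n)"
    and k: "\<And>j b. ({j, Suc j}, b) \<in> medges (add_parallel (path_graph n) Ed) \<Longrightarrow>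
              c ({j, Suc j}, b) = k j"
  shows "lir_2_colouring (add_parallel (path_graph n) Ed) c \<longleftrightarrow>
           (\<forall>j. Suc j < n \<longrightarrow> k j \<in> {1, 2} \<and>
              left_multiplicity (path_class_multiplicity n Ed k (k j)) j
                \<noteq> path_class_multiplicity n Ed k (k j) (Suc j))"
proof -
  let ?M = "add_parallel (path_graph n) Ed"
  define F where "F i = {e \<in> medges ?M. c e = i}" for i
  have medges: "medges ?M = gedges (path_graph n) \<times> {0} \<union> Ed \<times> {1}" and ends: "ends ?M = fst"
    by (simp_all add: add_parallel_def)
  have fin: "finite (F i)" for i
    using finite_gedges_path[of n] finite_subset[OF Ed] by (simp add: F_def medges)
  have sub: "fst ` F i \<subseteq> gedges (path_graph n)" for i
    using Ed by (auto simp: F_def medges)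
  have edge_cases: "\<exists>j b. e = ({j, Suc j}, b) \<and> Suc j < n \<and> c e = k j" if "e \<in> medges ?M" for e
  proof -
    obtain s b where e: "e = (s, b)"
      by (rule prod.exhaust)
    from that Ed have "s \<in> gedges (path_graph n)"
      by (auto simp: e medges)
    then obtain j where "s = {j, Suc j}" "Suc j < n"
      by (auto simp: path_graph_def)
    with that k show ?thesis
      unfolding e by blast
  qed
  have base_edge: "({j, Suc j}, 0) \<in> medges ?M" if "Suc j < n" for j
    using that by (simp add: medges path_edge_in_gedges_iff)
  have mem_F: "{j, Suc j} \<in> fst ` F i \<longleftrightarrow> Suc j < n \<and> k j = i" for i j
  proof
    assume "{j, Suc j} \<in> fst ` F i"
    then obtain e where e: "e \<in> medges ?M" "c e = i" "fst e = {j, Suc j}"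
      by (auto simp: F_def)
    obtain l b where l: "e = ({l, Suc l}, b)" "Suc l < n" "c e = k l"
      using edge_cases[OF e(1)] by blast
    have "l = j"
      using e(3) unfolding l(1) fst_conv path_edge_eq_iff .
    with e(2) l show "Suc j < n \<and> k j = i" by simp
  next
    assume "Suc j < n \<and> k j = i"
    then have "({j, Suc j}, 0) \<in> F i"
      using base_edge k by (simp add: F_def)
    then show "{j, Suc j} \<in> fst ` F i"
      by (rule rev_image_eqI) simp
  qed
  have mult: "card {e \<in> F i. fst e = {l, Suc l}} = path_class_multiplicity n Ed k i l" for i l
  proof (cases "Suc l < n \<and> k l = i")
    case True
    have "{e \<in> F i. fst e = {l, Suc l}} =
            {({l, Suc l}, 0)} \<union> (if {l, Suc l} \<in> Ed then {({l, Suc l}, 1)} else {})"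
      (is "?A = ?B")
    proof
      show "?A \<subseteq> ?B"
      proof
        fix e
        assume "e \<in> ?A"
        then have "e = ({l, Suc l}, snd e)" "e \<in> medges ?M"
          by (simp_all add: F_def prod_eq_iff)
        then show "e \<in> ?B"
          unfolding medges by (cases e) (simp, blast)
      qed
    next
      have "({l, Suc l}, b) \<in> F i" if "({l, Suc l}, b) \<in> medges ?M" for b
        using that True k by (simp add: F_def)
      then show "?B \<subseteq> ?A"
        using True base_edge[of l] by (simp add: medges)
    qed
    with True show ?thesis
      by (simp add: path_class_multiplicity_def)
  next
    case False
    then have "{l, Suc l} \<notin> fst ` F i"
      unfolding mem_F .
    then have empty: "{e \<in> F i. fst e = {l, Suc l}} = {}"
      by blast
    show ?thesis
      unfolding empty using False by (auto simp: path_class_multiplicity_def)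
  qed
  define P where "P i j \<longleftrightarrow> left_multiplicity (path_class_multiplicity n Ed k i) j
                           \<noteq> path_class_multiplicity n Ed k i (Suc j)" for i j
  have irregular: "locally_irregular (induced_by_edges ?M (F i)) \<longleftrightarrow>
      (\<forall>j. Suc j < n \<and> k j = i \<longrightarrow> P i j)" for i
    by (simp only: locally_irregular_induced_path_iff[OF fin sub] mult mem_F P_def)
  have colours: "(\<forall>e \<in> medges ?M. c e \<in> {1, 2}) \<longleftrightarrow> (\<forall>j. Suc j < n \<longrightarrow> k j \<in> {1, 2})"
  proof
    assume "\<forall>e \<in> medges ?M. c e \<in> {1, 2}"
    then show "\<forall>j. Suc j < n \<longrightarrow> k j \<in> {1, 2}"
      using base_edge k by metis
  next
    assume R: "\<forall>j. Suc j < n \<longrightarrow> k j \<in> {1, 2}"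
    show "\<forall>e \<in> medges ?M. c e \<in> {1, 2}"
    proof
      fix e
      assume "e \<in> medges ?M"
      from edge_cases[OF this] R show "c e \<in> {1, 2}" by metis
    qed
  qed
  have parallel: "\<forall>e \<in> medges ?M. \<forall>f \<in> medges ?M. ends ?M e = ends ?M f \<longrightarrow> c e = c f"
  proof (intro ballI impI)
    fix e f
    assume ef: "e \<in> medges ?M" "f \<in> medges ?M" "ends ?M e = ends ?M f"
    obtain i a where e: "e = ({i, Suc i}, a)" "c e = k i"
      using edge_cases[OF ef(1)] by blast
    obtain j b where f: "f = ({j, Suc j}, b)" "c f = k j"
      using edge_cases[OF ef(2)] by blast
    have "i = j"
      using ef(3) unfolding ends e(1) f(1) fst_conv path_edge_eq_iff .
    with e f show "c e = c f" by simp
  qed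
  have "(\<forall>j. Suc j < n \<longrightarrow> k j \<in> {1, 2}) \<and>
          (\<forall>i \<in> {1, 2}. \<forall>j. Suc j < n \<and> k j = i \<longrightarrow> P i j) \<longleftrightarrow>
        (\<forall>j. Suc j < n \<longrightarrow> k j \<in> {1, 2} \<and> P (k j) j)"
    by metis
  then show ?thesis
    unfolding lir_2_colouring_def F_def[symmetric] irregular colours P_def[symmetric]
      eqTrueI[OF parallel] simp_thms .
qed

lemma lir_2_colouring_pathI:
  assumes "Ed \<subseteq> gedges (path_graph n)"
    and "\<And>j. Suc j < n \<Longrightarrow> k j \<in> {1, 2}"
    and "\<And>j. Suc j < n \<Longrightarrow>
           left_multiplicity (path_class_multiplicity n Ed k (k j)) j
             \<noteq> path_class_multiplicity n Ed k (k j) (Suc j)"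
  shows "\<exists>c. lir_2_colouring (add_parallel (path_graph n) Ed) c"
proof -
  \<comment> \<open>The minimum recovers the number \<open>j\<close> from \<open>{j, Suc j}\<close>;
    ignoring the second component gives parallel edges the same colour.\<close>
  let ?c = "\<lambda>e. k (Min (fst e))"
  have "?c ({j, Suc j}, b) = k j" for j and b :: nat
    by simp
  from lir_2_colouring_path_iff[of Ed n ?c k, OF assms(1) this] assms(2,3) show ?thesis
    by blast
qed

lemma Suc_mod_2_neq: "Suc i mod 2 \<noteq> i mod 2"
  by presburger

section \<open>Explicit colourings\<close>

lemma lir_2_colouring_path_odd:
  assumes "odd n"
  shows "\<exists>c. lir_2_colouring (add_parallel (path_graph n) {}) c"
proof -
  \<comment> \<open>The colours run 1, 1, 2, 2, 1, 1, and so on.\<close>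
  define k :: "nat \<Rightarrow> nat" where "k j = 1 + j div 2 mod 2" for j
  have k_even: "k (2 * i) = 1 + i mod 2" and k_odd: "k (Suc (2 * i)) = 1 + i mod 2" for i
    by (simp_all add: k_def)
  let ?m = "path_class_multiplicity n {} k"
  show ?thesis
  proof (rule lir_2_colouring_pathI[where k = k])
    show "k j \<in> {1, 2}" for j
      by (auto simp: k_def)
    fix j
    assume j: "Suc j < n"
    show "left_multiplicity (?m (k j)) j \<noteq> ?m (k j) (Suc j)"
    proof (cases "even j")
      case True
      then obtain i where i: "j = 2 * i" ..
      \<comment> \<open>By parity the first edge of a pair is never the last edge of the path, so
        its partner exists.\<close>
      have "Suc (Suc j) < n"
        using j True assms by presburger
      then have right: "?m (k j) (Suc j) = 1"
        by (simp add: path_class_multiplicity_def i k_even k_odd)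
      have "left_multiplicity (?m (k j)) j = 0"
      proof (cases i)
        case (Suc h)
        then have pred: "j - 1 = Suc (2 * h)" and "j \<noteq> 0"
          by (simp_all add: i)
        then show ?thesis
          using Suc_mod_2_neq[of h, symmetric]
          unfolding left_multiplicity_def path_class_multiplicity_def pred
          unfolding i Suc k_even k_odd by simp
      qed (simp add: left_multiplicity_def i)
      with right show ?thesis by simp
    next
      case False
      then obtain i where i: "j = Suc (2 * i)"
        by (auto elim: oddE)
      have "left_multiplicity (?m (k j)) j = 1"
        using j by (simp add: left_multiplicity_def path_class_multiplicity_def i k_even k_odd)
      \<comment> \<open>The next edge either opens a pair of the other colour or lies beyond the
        path.\<close>
      moreover have "?m (k j) (Suc j) = 0"
        using k_even[of "Suc i"] Suc_mod_2_neq[of i]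
        by (simp add: path_class_multiplicity_def i k_odd)
      ultimately show ?thesis by simp
    qed
  qed simp
qed

lemma lir_2_colouring_path_even:
  assumes "even n" "n \<ge> 3"
  shows "\<exists>c. lir_2_colouring (add_parallel (path_graph n) {{0, Suc 0}}) c"
proof -
  \<comment> \<open>The colours run 1, 1, 1, 2, 2, 1, 1, and so on: truncated subtraction gives edge
    0 the colour of the first pair, formed by edges 1 and 2.\<close>
  define k :: "nat \<Rightarrow> nat" where "k j = 1 + (j - 1) div 2 mod 2" for j
  have k_0: "k 0 = 1" and k_odd: "k (Suc (2 * i)) = 1 + i mod 2"
    and k_even: "k (Suc (Suc (2 * i))) = 1 + i mod 2" for i
    by (simp_all add: k_def)
  let ?m = "path_class_multiplicity n {{0, Suc 0}} k"
  have m: "?m i l = (if Suc l < n \<and> k l = i then if l = 0 then 2 else 1 else 0)" for i l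
    unfolding path_class_multiplicity_def singleton_iff path_edge_eq_iff ..
  show ?thesis
  proof (rule lir_2_colouring_pathI[where k = k])
    show "{{0, Suc 0}} \<subseteq> gedges (path_graph n)"
      using assms path_edge_in_gedges_iff[of 0 n] by simp
    show "k j \<in> {1, 2}" for j
      by (auto simp: k_def)
    fix j
    assume j: "Suc j < n"
    \<comment> \<open>The cases are the doubled edge, the left edge of the first pair, the left edge
      of a later pair, and the right edge of any pair.\<close>
    consider "j = 0" | "j = 1" | h where "j = Suc (2 * Suc h)" | i where "j = Suc (Suc (2 * i))"
    proof (cases "even j")
      case True
      then obtain i where "j = 2 * i" ..
      then show ?thesis
        using that(1) that(4)[of "i - 1"] by (cases i) auto
    next
      case False
      then obtain i where "j = Suc (2 * i)"
        by (auto elim: oddE)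
      then show ?thesis
        using that(2) that(3)[of "i - 1"] by (cases i) auto
    qed
    then show "left_multiplicity (?m (k j)) j \<noteq> ?m (k j) (Suc j)"
    proof cases
      case 1
      then show ?thesis
        using assms k_odd[of 0] by (simp add: left_multiplicity_def m k_0)
    next
      \<comment> \<open>The doubled edge on the left has multiplicity 2, whereas the edge on the
        right contributes at most 1.\<close>
      case 2
      then show ?thesis
        using j k_odd[of 0] by (simp add: left_multiplicity_def m k_0)
    next
      case (3 h)
      then have pred: "j - 1 = Suc (Suc (2 * h))"
        by simp
      have "left_multiplicity (?m (k j)) j = 0"
        using Suc_mod_2_neq[of h, symmetric]
        unfolding left_multiplicity_def m pred unfolding 3 k_even k_odd by simp
      moreover have "Suc (Suc j) < n"
        using j 3 assms by presburger
      then have "?m (k j) (Suc j) = 1"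
        unfolding m unfolding 3 k_even k_odd by simp
      ultimately show ?thesis by simp
    next
      case (4 i)
      then have "left_multiplicity (?m (k j)) j = 1"
        using j by (simp add: left_multiplicity_def m k_even k_odd)
      moreover have "?m (k j) (Suc j) = 0"
        using k_odd[of "Suc i"] Suc_mod_2_neq[of i] by (simp add: m 4 k_even)
      ultimately show ?thesis by simp
    qed
  qed
qed

section \<open>Necessity of a doubled edge when the order is even\<close>

lemma odd_if_lir_2_colouring_path:
  assumes "n \<ge> 3" and "lir_2_colouring (add_parallel (path_graph n) {}) c"
  shows "odd n"
proof
  assume "even n"
  \<comment> \<open>With no doubled edges, copy 0 is the only one, so \<open>k\<close> captures all
    colours.\<close>
  define k where "k j = c ({j, Suc j}, 0)" for j
  have "c ({j, Suc j}, b) = k j"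
    if "({j, Suc j}, b) \<in> medges (add_parallel (path_graph n) {})" for j b
    using that by (simp add: add_parallel_def k_def)
  from lir_2_colouring_path_iff[of "{}" n c k, OF empty_subsetI this] assms(2)
  have irregular: "left_multiplicity (path_class_multiplicity n {} k (k j)) j
      \<noteq> path_class_multiplicity n {} k (k j) (Suc j)" if "Suc j < n" for j
    using that by blast
  \<comment> \<open>Here all multiplicities are 0 or 1, so being different means that exactly one of
    them is 1.\<close>
  have one_neighbour: "(0 < j \<and> k (j - 1) = k j) \<noteq> (Suc (Suc j) < n \<and> k (Suc j) = k j)"
    if "Suc j < n" for j
    using that irregular[OF that]
    by (cases j) (auto simp: left_multiplicity_def path_class_multiplicity_def split: if_splits)
  \<comment> \<open>Edge 0 has no left neighbour and must match edge 1. If edges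
    \<open>2 * i\<close> and \<open>2 * i + 1\<close> match, edge \<open>2 * i + 2\<close> must
    differ from them and hence match its right neighbour.\<close>
  have pairs: "Suc (2 * i) < n \<Longrightarrow> Suc (Suc (2 * i)) < n \<and> k (Suc (2 * i)) = k (2 * i)" for i
  proof (induction i)
    case 0
    with one_neighbour[of 0] show ?case by simp
  next
    case (Suc i)
    with one_neighbour[of "Suc (2 * i)"] one_neighbour[of "2 * Suc i"] show ?case by auto
  qed
  \<comment> \<open>For \<open>n = 2 * i + 2\<close>, edge \<open>2 * i\<close> is the last one and
    lacks the partner that \<open>pairs\<close> demands.\<close>
  from \<open>even n\<close> obtain m where "n = 2 * m" ..
  moreover from this assms(1) obtain i where "m = Suc i"
    by (cases m) auto
  ultimately show False
    using pairs[of i] by simp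
qed

theorem mainTheorem1:
  fixes n :: nat
  assumes "n \<ge> 3"
  shows "D_lir (path_graph n) = (if odd n then 0 else 1)"
proof (cases "odd n")
  case True
  have "D_lir (path_graph n) \<le> enat (card ({} :: nat set set))"
    unfolding D_lir_def using lir_2_colouring_path_odd[OF True] by (intro INF_lower) auto
  with True show ?thesis by (simp add: zero_enat_def[symmetric])
next
  case False
  have "D_lir (path_graph n) \<le> enat (card {{0, Suc 0}})"
    unfolding D_lir_def
    using lir_2_colouring_path_even[of n] False assms path_edge_in_gedges_iff[of 0 n]
    by (intro INF_lower) auto
  moreover have "1 \<le> D_lir (path_graph n)"
    unfolding D_lir_def
  proof (rule INF_greatest)
    fix Ed
    assume Ed: "Ed \<in> {Ed. Ed \<subseteq> gedges (path_graph n) \<and> finite Ed \<and>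
      (\<exists>c. lir_2_colouring (add_parallel (path_graph n) Ed) c)}"
    then have "Ed \<noteq> {}"
      using odd_if_lir_2_colouring_path[OF assms] False by blast
    \<comment> \<open>Finiteness of \<open>Ed\<close> matters, since \<open>card\<close> is 0 on
      infinite sets.\<close>
    with Ed have "1 \<le> card Ed"
      by (simp add: Suc_le_eq card_gt_0_iff)
    then show "1 \<le> enat (card Ed)"
      by (simp add: one_enat_def)
  qed
  ultimately show ?thesis
    using False by (simp add: one_enat_def)
qed

end
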